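(* Let $N_1,\dots,N_d$ be positive integers and $S=\prod_{j=1}^d[-N_j,N_j]\cap\mathbb{Z}^d$. Then $$\min_{p\in\Pi_S}\{\mathrm{var}^A_{GG}(p):\ \|p\|_{\mathbb{T}^d}=1\}=\left(d-\sum_{j=1}^d\cos^2\frac{\pi}{2N_j+2}\right)\left(\sum_{j=1}^d\cos\frac{\pi}{2N_j+2}\right)^{-2},$$ and this minimum is attained by the trigonometric polynomial $p_{\min}\in\Pi_S$ with Fourier coefficients $$c_k=\prod_{j=1}^d\frac{1}{\sqrt{N_j+1}}\sin\frac{\pi l_j}{2N_j+2},\qquad l_j=k_j+N_j+1,\quad j=1,\dots,d,\quad k=(k_1,\dots,k_d)\in S.$$
   Context: $\mathbb{T}^d=\mathbb{R}^d/\mathbb{Z}^d$; $\|f\|_{\mathbb{T}^d}^2=\int_{\mathbb{T}^d}|f|^2\,dx$. For finite $S\subset\mathbb{Z}^d$, $\Pi_S=\{\sum_{k\in S}c_ke^{2\pi i\langle k,x\rangle}:c_k\in\mathbb{C}\}$. Let $e_1,\dots,e_d$ be the standard basis of $\mathbb{R}^d$. The Goh–Goodman angular variance of $f\in H^1(\mathbb{T}^d)$ with Fourier coefficients $c_k=\int_{\mathbb{T}^d} f(x)e^{-2\pi i\langle k,x\rangle}\,dx$ is $$\mathrm{var}^A_{GG}(f)=\frac{\sum_{j=1}^d\left(\|f\|_{\mathbb{T}^d}^4-\left|\sum_{k\in\mathbb{Z}^d}c_{k-e_j}\overline{c_k}\right|^2\right)}{\left(\sum_{j=1}^d\left|\sum_{k\in\mathbb{Z}^d}c_{k-e_j}\overline{c_k}\right|\right)^2},$$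 with value $\infty$ if the denominator is zero. In particular, if $\|f\|_{\mathbb{T}^d}=1$ the numerator is $d-\sum_{j=1}^d\left|\sum_{k}c_{k-e_j}\overline{c_k}\right|^2$. *)

theory Defs
  imports "HOL-Analysis.Analysis"
begin

text \<open>
  Functions on the torus are represented by \<open>\<int>\<^sup>d\<close>-periodic functions on \<open>\<real>\<^sup>d\<close>; integration over
  the torus is Lebesgue integration over the unit cube \<open>cbox 0 1\<close>, where \<open>1\<close> is the
  all-ones vector. The dimension \<open>d\<close> is \<open>CARD('d)\<close>.
\<close>

definition torus_norm :: "(real ^ 'd::finite \<Rightarrow> complex) \<Rightarrow> real" where
  "torus_norm f = sqrt (LINT x:cbox 0 1|lborel. (cmod (f x))\<^sup>2)"

definition character :: "int ^ 'd::finite \<Rightarrow> real ^ 'd \<Rightarrow> complex" where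
  "character k x = exp (2 * of_real pi * \<i> * of_real (\<Sum>j\<in>UNIV. of_int (k $ j) * x $ j))"

definition fourier_coeff :: "(real ^ 'd::finite \<Rightarrow> complex) \<Rightarrow> int ^ 'd \<Rightarrow> complex" where
  "fourier_coeff f k = (LINT x:cbox 0 1|lborel. f x * character (- k) x)"

definition trig_poly :: "(int ^ 'd::finite) set \<Rightarrow> (int ^ 'd \<Rightarrow> complex) \<Rightarrow> real ^ 'd \<Rightarrow> complex" where
  "trig_poly S c x = (\<Sum>k\<in>S. c k * character k x)"

definition trig_polys :: "(int ^ 'd::finite) set \<Rightarrow> (real ^ 'd \<Rightarrow> complex) set" where
  "trig_polys S = {trig_poly S c | c. True}"

text \<open>
  The frequency sums below converge absolutely for square-integrable \<open>f\<close>, in particular for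
  \<open>f \<in> H\<^sup>1\<close>, so \<open>infsum\<close> is the genuine sum there; outside that domain no meaning is intended.
\<close>

definition shift_corr :: "(real ^ 'd::finite \<Rightarrow> complex) \<Rightarrow> 'd \<Rightarrow> complex" where
  "shift_corr f j = (\<Sum>\<^sub>\<infinity>k. fourier_coeff f (k - axis j 1) * cnj (fourier_coeff f k))"

definition var_GG :: "(real ^ 'd::finite \<Rightarrow> complex) \<Rightarrow> ereal" where
  "var_GG f =
    (let num = (\<Sum>j\<in>UNIV. torus_norm f ^ 4 - (cmod (shift_corr f j))\<^sup>2);
         den = (\<Sum>j\<in>UNIV. cmod (shift_corr f j))\<^sup>2
     in if den = 0 then \<infinity> else ereal (num / den))"

definition freq_box :: "('d::finite \<Rightarrow> nat) \<Rightarrow> (int ^ 'd) set" where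
  "freq_box N = {k. \<forall>j. - int (N j) \<le> k $ j \<and> k $ j \<le> int (N j)}"

definition min_coeff :: "('d::finite \<Rightarrow> nat) \<Rightarrow> int ^ 'd \<Rightarrow> real" where
  "min_coeff N k =
    (\<Prod>j\<in>UNIV. 1 / sqrt (real (N j) + 1) *
       sin (pi * of_int (k $ j + int (N j) + 1) / (2 * real (N j) + 2)))"

definition p_min :: "('d::finite \<Rightarrow> nat) \<Rightarrow> real ^ 'd \<Rightarrow> complex" where
  "p_min N = trig_poly (freq_box N) (\<lambda>k. complex_of_real (min_coeff N k))"

definition min_var :: "('d::finite \<Rightarrow> nat) \<Rightarrow> real" where
  "min_var N =
    (real CARD('d) - (\<Sum>j\<in>UNIV. (cos (pi / (2 * real (N j) + 2)))\<^sup>2)) /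
    (\<Sum>j\<in>UNIV. cos (pi / (2 * real (N j) + 2)))\<^sup>2"

end

theory Submission
  imports Defs
begin

text \<open>
  By orthogonality of the characters, the \<open>j\<close>-th frequency sum of \<open>p \<in> \<Pi>\<^sub>S\<close> is a quadratic form
  in the coefficients, namely half the adjacency form of the path with \<open>2 N\<^sub>j + 1\<close> vertices acting
  on the \<open>j\<close>-th coordinate. The positive eigenvector \<open>w\<^sub>j k = sin (\<pi> l\<^sub>j / (2 N\<^sub>j + 2))\<close> satisfies
  \<open>w\<^sub>j (k - e\<^sub>j) + w\<^sub>j (k + e\<^sub>j) = 2 cos (\<pi> / (2 N\<^sub>j + 2)) w\<^sub>j k\<close>, so the AM-GM inequality weighted
  by ratios of \<open>w\<^sub>j\<close> bounds the form by \<open>cos (\<pi> / (2 N\<^sub>j + 2))\<close>, with equality for all \<open>j\<close>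
  simultaneously if the coefficients are the product of the \<open>w\<^sub>j\<close>. The variance decreases in
  each of the \<open>d\<close> moduli.
\<close>

section \<open>Orthogonality of the characters on the unit cube\<close>

lemma lborel_integral_prod_Basis:
  fixes f :: "'a::euclidean_space \<Rightarrow> real \<Rightarrow> complex"
  assumes int: "\<And>b. b \<in> Basis \<Longrightarrow> integrable lborel (f b)"
  shows "(LINT x|lborel. (\<Prod>b\<in>Basis. f b (x \<bullet> b))) = (\<Prod>b\<in>Basis. LINT t|lborel. f b t)"
proof -
  interpret product_sigma_finite "\<lambda>_::'a. lborel :: real measure"
    by standard
  have [measurable]: "f b \<in> borel_measurable borel" if "b \<in> Basis" for b
    using borel_measurable_integrable[OF int[OF that]] by simp
  \<comment> \<open>\<open>lborel\<close> is the image of the product of one-dimensional measures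
    under the expansion in coordinates, so the integral moves to the product space, where it
    factors.\<close>
  have "(LINT x|lborel. (\<Prod>b\<in>Basis. f b (x \<bullet> b))) =
      (LINT y|(\<Pi>\<^sub>M b\<in>Basis. lborel). (\<Prod>b\<in>Basis. f b ((\<Sum>c\<in>Basis. y c *\<^sub>R c) \<bullet> b)))"
    by (subst lborel_eq, subst integral_distr) auto
  also have "\<dots> = (LINT y|(\<Pi>\<^sub>M b\<in>Basis. lborel). (\<Prod>b\<in>Basis. f b (y b)))"
    by (intro Bochner_Integration.integral_cong prod.cong refl) simp
  also have "\<dots> = (\<Prod>b\<in>Basis. LINT t|lborel. f b t)"
    by (rule product_integral_prod) (auto intro: int)
  finally show ?thesis .
qed

lemma lborel_integral_prod_vec:
  fixes f :: "'d::finite \<Rightarrow> real \<Rightarrow> complex"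
  assumes "\<And>j. integrable lborel (f j)"
  shows "(LINT x|lborel. (\<Prod>j\<in>UNIV. f j ((x :: real ^ 'd) $ j))) = (\<Prod>j\<in>UNIV. LINT t|lborel. f j t)"
proof -
  define ax :: "'d \<Rightarrow> real ^ 'd" where "ax = (\<lambda>j. axis j 1)"
  have inj: "inj ax"
    by (auto simp: inj_def ax_def axis_eq_axis)
  have Basis: "(Basis :: (real ^ 'd) set) = range ax"
    by (auto simp: Basis_vec_def ax_def)
  have dot: "x \<bullet> ax j = x $ j" for x j
    by (simp add: ax_def inner_axis)
  show ?thesis
    using lborel_integral_prod_Basis[of "\<lambda>b. f (inv ax b)"] assms
    by (simp add: Basis prod.reindex[OF inj] inv_f_f[OF inj] dot)
qed

lemma exp_2pi_int_integral:
  "(LINT t|lborel. indicator {0..1} t *\<^sub>R exp (2 * of_real pi * \<i> * of_real (of_int m * t))) =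
    (if m = 0 then 1 else 0)"
proof (cases "m = 0")
  case False
  define z :: complex where "z = 2 * of_real pi * \<i> * of_int m"
  have z: "z \<noteq> 0"
    using False by (simp add: z_def)
  have expz: "exp z = 1"
    unfolding z_def exp_eq_1 by (auto intro!: exI[of _ m])
  \<comment> \<open>The antiderivative \<open>exp (z * of_real t) / z\<close> takes equal values at
    both ends because \<open>exp z = 1\<close>.\<close>
  have "(LINT t|lborel. indicator {0..1} t *\<^sub>R exp (z * of_real t)) = exp (z * of_real 1) / z - exp (z * of_real 0) / z"
  proof (rule integral_FTC_atLeastAtMost)
    show "((\<lambda>t. exp (z * of_real t) / z) has_vector_derivative exp (z * of_real t)) (at t within {0..1})" for t
      using z by (auto intro!: derivative_eq_intros has_vector_derivative_real_field simp: field_simps)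
  qed (auto intro!: continuous_intros)
  then show ?thesis
    using False expz by (simp add: z_def mult_ac)
qed simp

lemma continuous_on_character: "continuous_on A (character k)"
  unfolding character_def by (intro continuous_intros)

lemma character_integrable: "set_integrable lborel (cbox 0 1) (character k)"
  unfolding set_integrable_def
  by (intro borel_integrable_compact compact_cbox continuous_on_character)

lemma character_mult: "character k x * character m x = character (k + m) x"
  by (simp add: character_def exp_add[symmetric] sum.distrib ring_distribs)

lemma cnj_character: "cnj (character k x) = character (- k) x"
  by (simp add: character_def exp_cnj sum_negf)

text \<open>The indicator of the cube and the character both factor over the coordinates, so a
  single nonzero \<open>k $ j\<close> makes the whole product of one-dimensional integrals
  vanish.\<close>

lemma character_integral:
  fixes k :: "int ^ 'd::finite"
  shows "(LINT x:cbox 0 1|lborel. character k x) = (if k = 0 then 1 else 0)"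
proof -
  define g where
    "g j t = indicator {0..1} t *\<^sub>R exp (2 * of_real pi * \<i> * of_real (of_int (k $ j) * t))" for j and t :: real
  have "indicator (cbox 0 1) x *\<^sub>R character k x = (\<Prod>j\<in>UNIV. g j (x $ j))" for x :: "real ^ 'd"
  proof -
    have "(indicator (cbox 0 1) x :: real) = (\<Prod>j\<in>UNIV. indicator {0..1} (x $ j))"
      by (auto simp: indicator_def mem_box_cart)
    then show ?thesis
      by (simp add: g_def character_def prod.distrib scaleR_conv_of_real sum_distrib_left exp_sum)
  qed
  moreover have "integrable lborel (g j)" for j
    unfolding g_def by (intro borel_integrable_compact continuous_intros) auto
  ultimately have "(LINT x:cbox 0 1|lborel. character k x) = (\<Prod>j\<in>UNIV. LINT t|lborel. g j t)"
    using lborel_integral_prod_vec[of g] by (simp add: set_lebesgue_integral_def)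
  also have "\<dots> = (\<Prod>j\<in>UNIV. if k $ j = 0 then 1 else 0)"
    by (simp add: g_def exp_2pi_int_integral[simplified])
  also have "\<dots> = (if k = 0 then 1 else 0)"
    by (auto simp: vec_eq_iff)
  finally show ?thesis .
qed

text \<open>Indices and frequencies are kept apart because frequencies may repeat: \<open>I\<close>
  is \<open>S\<close> for Fourier coefficients and \<open>S \<times> S\<close> for the norm.\<close>

lemma set_integral_sum_character:
  assumes "finite I"
  shows "(LINT x:cbox 0 1|lborel. (\<Sum>i\<in>I. c i * character (m i) x)) = (\<Sum>i\<in>I. if m i = 0 then c i else 0)"
proof -
  have "integrable lborel (\<lambda>x. indicator (cbox 0 1) x *\<^sub>R (c i * character (m i) x))" for i
    using set_integrable_mult_right[OF character_integrable, of "c i"] by (simp add: set_integrable_def)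
  then have "(LINT x:cbox 0 1|lborel. (\<Sum>i\<in>I. c i * character (m i) x)) =
      (\<Sum>i\<in>I. LINT x:cbox 0 1|lborel. c i * character (m i) x)"
    unfolding set_lebesgue_integral_def scaleR_sum_right by (rule Bochner_Integration.integral_sum)
  then show ?thesis
    by (simp only: set_integral_mult_right character_integral) (simp add: if_distrib cong: if_cong)
qed

section \<open>Coefficients, norm and frequency sums of trigonometric polynomials\<close>

lemma fourier_coeff_trig_poly:
  assumes "finite S"
  shows "fourier_coeff (trig_poly S c) k = (if k \<in> S then c k else 0)"
proof -
  have "fourier_coeff (trig_poly S c) k = (LINT x:cbox 0 1|lborel. (\<Sum>i\<in>S. c i * character (i - k) x))"
    by (simp add: fourier_coeff_def trig_poly_def sum_distrib_right mult.assoc character_mult)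
  then show ?thesis
    using assms by (simp add: set_integral_sum_character)
qed

text \<open>Parseval for finite sums: the squared modulus expands into a double sum, of which
  integration keeps the diagonal. The computation is complex-valued and is pulled back along
  \<open>complex_of_real\<close>.\<close>

lemma torus_norm_trig_poly:
  assumes "finite S"
  shows "torus_norm (trig_poly S c) = sqrt (\<Sum>k\<in>S. (cmod (c k))\<^sup>2)"
proof -
  have pointwise: "complex_of_real ((cmod (trig_poly S c x))\<^sup>2) =
      (\<Sum>(k, m)\<in>S \<times> S. (c k * cnj (c m)) * character (k - m) x)" for x
  proof -
    have "character k x * cnj (character m x) = character (k - m) x" for k m
      by (simp add: cnj_character character_mult)
    then have "(c k * character k x) * cnj (c m * character m x) = (c k * cnj (c m)) * character (k - m) x" for k m
      by (simp add: mult_ac)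
    then show ?thesis
      by (simp only: complex_norm_square trig_poly_def cnj_sum sum_product sum.cartesian_product)
  qed
  have "complex_of_real (LINT x:cbox 0 1|lborel. (cmod (trig_poly S c x))\<^sup>2) =
      (LINT x:cbox 0 1|lborel. complex_of_real ((cmod (trig_poly S c x))\<^sup>2))"
    by (simp add: set_lebesgue_integral_def scaleR_conv_of_real flip: integral_complex_of_real)
  also have "\<dots> = (LINT x:cbox 0 1|lborel. (\<Sum>(k, m)\<in>S \<times> S. (c k * cnj (c m)) * character (k - m) x))"
    by (simp only: pointwise)
  also have "\<dots> =
      (\<Sum>(k, m)\<in>S \<times> S. if k = m then c k * cnj (c m) else 0)"
    using set_integral_sum_character[of "S \<times> S" "\<lambda>(k, m). c k * cnj (c m)" "\<lambda>(k, m). k - m"] assms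
    by (simp add: case_prod_beta cong: if_cong)
  also have "\<dots> = (\<Sum>k\<in>S. c k * cnj (c k))"
    using assms by (simp add: sum.cartesian_product[symmetric])
  also have "\<dots> = complex_of_real (\<Sum>k\<in>S. (cmod (c k))\<^sup>2)"
    by (simp only: of_real_sum complex_norm_square)
  finally show ?thesis
    unfolding torus_norm_def of_real_eq_iff by simp
qed

text \<open>Coefficients vanish off \<open>S\<close>, which makes the infinite sum finite. The
  neighbour of a point of \<open>S\<close> may lie outside, hence the default 0.\<close>

lemma shift_corr_trig_poly:
  assumes "finite S"
  shows "shift_corr (trig_poly S c) j =
    (\<Sum>k\<in>S. (if k - axis j 1 \<in> S then c (k - axis j 1) else 0) * cnj (c k))"
proof -
  have "shift_corr (trig_poly S c) j =
      infsum (\<lambda>k. (if k - axis j 1 \<in> S then c (k - axis j 1) else 0) * cnj (c k)) S"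
    unfolding shift_corr_def by (rule infsum_cong_neutral) (auto simp: fourier_coeff_trig_poly assms)
  then show ?thesis
    using assms by simp
qed

section \<open>The frequency box as a product of intervals\<close>

lemma freq_box_eq_image: "freq_box N = vec_lambda ` (\<Pi>\<^sub>E j\<in>UNIV. {- int (N j)..int (N j)})"
proof (intro equalityI subsetI)
  fix k assume "k \<in> freq_box N"
  then have "vec_nth k \<in> (\<Pi>\<^sub>E j\<in>UNIV. {- int (N j)..int (N j)})"
    by (auto simp: freq_box_def)
  then show "k \<in> vec_lambda ` (\<Pi>\<^sub>E j\<in>UNIV. {- int (N j)..int (N j)})"
    by (metis image_eqI vec_nth_inverse)
qed (auto simp: freq_box_def PiE_def Pi_def)

lemma finite_freq_box: "finite (freq_box N)"
  unfolding freq_box_eq_image by (intro finite_imageI finite_PiE) auto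

text \<open>Distributivity over a \<open>PiE\<close> set; it splits the norm of a product of
  one-dimensional coefficients into one-dimensional sums.\<close>

lemma sum_freq_box_prod:
  fixes f :: "'d::finite \<Rightarrow> int \<Rightarrow> real"
  shows "(\<Sum>k\<in>freq_box N. \<Prod>j\<in>UNIV. f j (k $ j)) = (\<Prod>j\<in>UNIV. \<Sum>m\<in>{- int (N j)..int (N j)}. f j m)"
  by (simp add: freq_box_eq_image prod_sum_PiE sum.reindex inj_on_def vec_lambda_inject)

section \<open>The sine eigenvector of the path\<close>

definition sine_weight :: "nat \<Rightarrow> int \<Rightarrow> real" where
  "sine_weight n m = sin (pi * of_int (m + int n + 1) / (2 * real n + 2))"

lemma sine_weight_pos:
  assumes "- int n \<le> m" "m \<le> int n"
  shows "sine_weight n m > 0"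
  unfolding sine_weight_def
proof (rule sin_gt_zero)
  define t where "t = real_of_int (m + int n + 1)"
  have "0 < t" "t < 2 * real n + 2"
    using assms unfolding t_def by linarith+
  then show "0 < pi * of_int (m + int n + 1) / (2 * real n + 2)"
    "pi * of_int (m + int n + 1) / (2 * real n + 2) < pi"
    unfolding t_def[symmetric] by (simp_all add: divide_less_eq)
qed

text \<open>The zeros one step beyond either end are the Dirichlet conditions: they let the
  three-term recurrence hold at the end vertices, whose missing neighbour has weight 0.\<close>

lemma sine_weight_lower: "sine_weight n (- int n - 1) = 0"
  by (simp add: sine_weight_def)

lemma sine_weight_upper: "sine_weight n (int n + 1) = 0"
proof -
  have "pi * of_int (int n + 1 + int n + 1) / (2 * real n + 2) = pi"
    by (simp add: field_simps)
  then show ?thesis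
    by (simp add: sine_weight_def)
qed

text \<open>One index step changes the angle by \<open>h\<close>, and sin (a - h) + sin (a + h) = 2
  cos h sin a.\<close>

lemma sine_weight_recurrence:
  "sine_weight n (m - 1) + sine_weight n (m + 1) = 2 * cos (pi / (2 * real n + 2)) * sine_weight n m"
proof -
  define a where "a = pi * of_int (m + int n + 1) / (2 * real n + 2)"
  define h where "h = pi / (2 * real n + 2)"
  have "pi * of_int (m - 1 + int n + 1) / (2 * real n + 2) = a - h"
    "pi * of_int (m + 1 + int n + 1) / (2 * real n + 2) = a + h"
    by (simp_all add: a_def h_def ring_distribs diff_divide_distrib add_divide_distrib)
  then show ?thesis
    unfolding sine_weight_def a_def[symmetric] h_def[symmetric] by (simp add: sin_add sin_diff)
qed

text \<open>Indices \<open>l\<close> and \<open>M + l\<close> have angles differing by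
  \<open>pi / 2\<close>, so their squares add up to 1; there are \<open>M = n + 1\<close> such
  pairs.\<close>

lemma sum_sine_weight_squared:
  "(\<Sum>m\<in>{- int n..int n}. (sine_weight n m)\<^sup>2) = real n + 1"
proof -
  define M where "M = Suc n"
  define g where "g l = (sin (pi * real l / (2 * real M)))\<^sup>2" for l
  have "(\<Sum>m\<in>{- int n..int n}. (sine_weight n m)\<^sup>2) = (\<Sum>l\<in>{1..<2 * M}. g l)"
    by (rule sum.reindex_bij_witness[of _ "\<lambda>l. int l - int n - 1" "\<lambda>m. nat (m + int n + 1)"])
       (auto simp: g_def sine_weight_def M_def algebra_simps)
  \<comment> \<open>The vanishing term at \<open>l = 0\<close> is added to complete the
    pairing.\<close>
  also have "\<dots> = (\<Sum>l<M + M. g l)"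
    by (intro sum.mono_neutral_left) (auto simp: g_def not_le Suc_le_eq)
  also have "\<dots> = (\<Sum>l<M. g l) + (\<Sum>l<M. g (M + l))"
    by (simp add: sum.nat_group[symmetric] lessThan_atLeast0 sum.atLeastLessThan_concat[of 0 M "M + M", symmetric]
        sum.shift_bounds_nat_ivl[of g 0 M M, simplified] add.commute)
  also have "\<dots> = (\<Sum>l<M. g l + g (M + l))"
    by (simp add: sum.distrib)
  also have "\<dots> = (\<Sum>l<M. 1)"
  proof (rule sum.cong[OF refl])
    fix l
    have "pi * real (M + l) / (2 * real M) = pi * real l / (2 * real M) + pi / 2"
      by (simp add: M_def field_simps)
    then show "g l + g (M + l) = 1"
      by (simp add: g_def sin_add)
  qed
  finally show ?thesis
    by (simp add: M_def)
qed

section \<open>The shifted quadratic form and its sharp bound\<close>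

lemma sum_shift_neutral:
  fixes f :: "'a::ab_group_add \<Rightarrow> real"
  assumes "finite S" "\<And>m. m \<notin> S \<Longrightarrow> f m = 0" "\<And>m. m \<in> S \<Longrightarrow> m + e \<notin> S \<Longrightarrow> f m = 0"
  shows "(\<Sum>k\<in>S. f (k - e)) = (\<Sum>k\<in>S. f k)"
  \<comment> \<open>After translation the two sums differ only by points outside \<open>S\<close>
    and by points of \<open>S\<close> that \<open>e\<close> moves out of it; \<open>f\<close>
    vanishes on both.\<close>
  using assms
  by (intro sum.reindex_bij_witness_not_neutral[of "{k \<in> S. k - e \<notin> S}" "{k \<in> S. k + e \<notin> S}" _ "\<lambda>k. k + e" "\<lambda>k. k - e"])
     auto

lemma freq_box_shift:
  assumes "k \<in> freq_box N"
  shows "k - axis j 1 \<in> freq_box N \<longleftrightarrow> k $ j \<noteq> - int (N j)"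
    and "k + axis j 1 \<in> freq_box N \<longleftrightarrow> k $ j \<noteq> int (N j)"
proof -
  have bounds: "- int (N i) \<le> k $ i" "k $ i \<le> int (N i)" for i
    using assms by (simp_all add: freq_box_def)
  have "- int (N i) \<le> (k - axis j 1) $ i \<and> (k - axis j 1) $ i \<le> int (N i) \<longleftrightarrow>
      i = j \<longrightarrow> k $ j \<noteq> - int (N j)" for i
    using bounds[of i] by (auto simp: axis_def)
  then show "k - axis j 1 \<in> freq_box N \<longleftrightarrow> k $ j \<noteq> - int (N j)"
    unfolding freq_box_def by simp
  have "- int (N i) \<le> (k + axis j 1) $ i \<and> (k + axis j 1) $ i \<le> int (N i) \<longleftrightarrow>
      i = j \<longrightarrow> k $ j \<noteq> int (N j)" for i
    using bounds[of i] by (auto simp: axis_def)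
  then show "k + axis j 1 \<in> freq_box N \<longleftrightarrow> k $ j \<noteq> int (N j)"
    unfolding freq_box_def by simp
qed

text \<open>This evaluates the upper side of the weighted AM-GM inequality, and serves both the
  bound and its equality case. Translating the second summand by one step collects both neighbours
  of \<open>k\<close> in front of \<open>(a k)\<^sup>2\<close>, where the recurrence
  applies.\<close>

lemma sum_shift_sine_ratios:
  fixes a :: "int ^ 'd::finite \<Rightarrow> real"
  assumes a: "\<And>k. k \<notin> freq_box N \<Longrightarrow> a k = 0"
  defines "w \<equiv> (\<lambda>j (k :: int ^ 'd). sine_weight (N j) (k $ j))"
  shows "(\<Sum>k\<in>freq_box N. w j (k - axis j 1) / w j k * (a k)\<^sup>2 + w j k / w j (k - axis j 1) * (a (k - axis j 1))\<^sup>2) =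
    2 * cos (pi / (2 * real (N j) + 2)) * (\<Sum>k\<in>freq_box N. (a k)\<^sup>2)"
proof -
  \<comment> \<open>The second summand is \<open>f (k - axis j 1)\<close>.\<close>
  define f where "f k = w j (k + axis j 1) / w j k * (a k)\<^sup>2" for k
  have "(\<Sum>k\<in>freq_box N. f (k - axis j 1)) = (\<Sum>k\<in>freq_box N. f k)"
  proof (rule sum_shift_neutral[OF finite_freq_box])
    \<comment> \<open>On the upper face the weight of the outer neighbour is 0, so the translation
      loses nothing.\<close>
    fix k assume "k \<in> freq_box N" "k + axis j 1 \<notin> freq_box N"
    then show "f k = 0"
      by (simp add: f_def w_def freq_box_shift sine_weight_upper)
  qed (simp add: f_def a)
  then have "(\<Sum>k\<in>freq_box N. w j (k - axis j 1) / w j k * (a k)\<^sup>2 + w j k / w j (k - axis j 1) * (a (k - axis j 1))\<^sup>2) =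
      (\<Sum>k\<in>freq_box N. w j (k - axis j 1) / w j k * (a k)\<^sup>2 + f k)"
    by (simp add: sum.distrib f_def)
  also have "\<dots> = (\<Sum>k\<in>freq_box N. 2 * cos (pi / (2 * real (N j) + 2)) * (a k)\<^sup>2)"
  proof (rule sum.cong[OF refl])
    fix k assume "k \<in> freq_box N"
    then have "w j k > 0"
      by (simp add: w_def freq_box_def sine_weight_pos)
    moreover have "w j (k - axis j 1) + w j (k + axis j 1) = 2 * cos (pi / (2 * real (N j) + 2)) * w j k"
      using sine_weight_recurrence[of "N j" "k $ j"] by (simp add: w_def)
    ultimately show "w j (k - axis j 1) / w j k * (a k)\<^sup>2 + f k = 2 * cos (pi / (2 * real (N j) + 2)) * (a k)\<^sup>2"
      by (simp add: f_def distrib_right[symmetric] add_divide_distrib[symmetric])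
  qed
  finally show ?thesis
    by (simp add: sum_distrib_left)
qed

lemma shift_form_le:
  fixes a :: "int ^ 'd::finite \<Rightarrow> real"
  assumes a: "\<And>k. k \<notin> freq_box N \<Longrightarrow> a k = 0"
  shows "(\<Sum>k\<in>freq_box N. a (k - axis j 1) * a k) \<le> cos (pi / (2 * real (N j) + 2)) * (\<Sum>k\<in>freq_box N. (a k)\<^sup>2)"
proof -
  define w where "w k = sine_weight (N j) (k $ j)" for k :: "int ^ 'd"
  have w: "w k > 0" if "k \<in> freq_box N" for k
    using that by (simp add: w_def freq_box_def sine_weight_pos)
  have "(\<Sum>k\<in>freq_box N. 2 * (a (k - axis j 1) * a k)) \<le>
      (\<Sum>k\<in>freq_box N. w (k - axis j 1) / w k * (a k)\<^sup>2 + w k / w (k - axis j 1) * (a (k - axis j 1))\<^sup>2)"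
  proof (rule sum_mono)
    fix k assume k: "k \<in> freq_box N"
    show "2 * (a (k - axis j 1) * a k) \<le> w (k - axis j 1) / w k * (a k)\<^sup>2 + w k / w (k - axis j 1) * (a (k - axis j 1))\<^sup>2"
    proof (cases "k - axis j 1 \<in> freq_box N")
      case True
      define x y where "x = w (k - axis j 1)" and "y = w k"
      have "x > 0" "y > 0"
        using True k by (simp_all add: x_def y_def w)
      \<comment> \<open>Expanding this square and dividing by \<open>x * y\<close> is AM-GM with
        weights \<open>x / y\<close> and \<open>y / x\<close>.\<close>
      moreover have "0 \<le> (x * a k - y * a (k - axis j 1))\<^sup>2 / (x * y)"
        using \<open>x > 0\<close> \<open>y > 0\<close> by simp
      ultimately show ?thesis
        unfolding x_def[symmetric] y_def[symmetric] by (simp add: field_simps power2_eq_square)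
    next
      case False
      \<comment> \<open>On the lower face both \<open>w\<close> and \<open>a\<close> vanish at the
        outer neighbour, so both sides are 0.\<close>
      then have "w (k - axis j 1) = 0"
        using k by (simp add: w_def freq_box_shift sine_weight_lower)
      then show ?thesis
        using False by (simp add: a)
    qed
  qed
  then show ?thesis
    using sum_shift_sine_ratios[of N a j, OF a] by (simp add: w_def sum_distrib_left[symmetric])
qed

text \<open>Proportionality to the sine weights in direction \<open>j\<close> is the equality case
  of AM-GM. The hypothesis is cross-multiplied so that it also covers the lower face, where the
  neighbouring weight is 0.\<close>

lemma shift_form_eq:
  fixes a :: "int ^ 'd::finite \<Rightarrow> real"
  assumes a: "\<And>k. k \<notin> freq_box N \<Longrightarrow> a k = 0"
    and ratio: "\<And>k. k \<in> freq_box N \<Longrightarrow>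
      a (k - axis j 1) * sine_weight (N j) (k $ j) = a k * sine_weight (N j) (k $ j - 1)"
  shows "(\<Sum>k\<in>freq_box N. a (k - axis j 1) * a k) = cos (pi / (2 * real (N j) + 2)) * (\<Sum>k\<in>freq_box N. (a k)\<^sup>2)"
proof -
  define w where "w k = sine_weight (N j) (k $ j)" for k :: "int ^ 'd"
  have "(\<Sum>k\<in>freq_box N. 2 * (a (k - axis j 1) * a k)) =
      (\<Sum>k\<in>freq_box N. w (k - axis j 1) / w k * (a k)\<^sup>2 + w k / w (k - axis j 1) * (a (k - axis j 1))\<^sup>2)"
  proof (rule sum.cong[OF refl])
    fix k assume k: "k \<in> freq_box N"
    have wk: "w k > 0"
      using k by (simp add: w_def freq_box_def sine_weight_pos)
    have p: "a (k - axis j 1) * w k = a k * w (k - axis j 1)"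
      using ratio[OF k] by (simp add: w_def)
    then have "a (k - axis j 1) = w (k - axis j 1) / w k * a k"
      using wk by (simp add: field_simps)
    \<comment> \<open>If the neighbouring weight is 0, the preceding equation gives
      \<open>a (k - axis j 1) = 0\<close> and both sides vanish.\<close>
    moreover from this wk
    have "w k / w (k - axis j 1) * (a (k - axis j 1))\<^sup>2 = a (k - axis j 1) * a k"
      by (cases "w (k - axis j 1) = 0") (simp_all add: power2_eq_square)
    ultimately show "2 * (a (k - axis j 1) * a k) =
        w (k - axis j 1) / w k * (a k)\<^sup>2 + w k / w (k - axis j 1) * (a (k - axis j 1))\<^sup>2"
      by (simp add: power2_eq_square)
  qed
  then show ?thesis
    using sum_shift_sine_ratios[of N a j, OF a] by (simp add: w_def sum_distrib_left[symmetric])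
qed

text \<open>Replacing coefficients by their moduli preserves the norm and, by the triangle
  inequality, does not lower the bound on the frequency sum; this reduces to the real form.\<close>

lemma cmod_shift_corr_le:
  assumes "p \<in> trig_polys (freq_box N)" "torus_norm p = 1"
  shows "cmod (shift_corr p j) \<le> cos (pi / (2 * real (N j) + 2))"
proof -
  obtain c where p: "p = trig_poly (freq_box N) c"
    using assms by (auto simp: trig_polys_def)
  define a where "a k = (if k \<in> freq_box N then cmod (c k) else 0)" for k
  have "(\<Sum>k\<in>freq_box N. (a k)\<^sup>2) = 1"
    using assms(2) by (simp add: p torus_norm_trig_poly finite_freq_box a_def)
  moreover have "cmod (shift_corr p j) \<le> (\<Sum>k\<in>freq_box N. a (k - axis j 1) * a k)"
    unfolding p shift_corr_trig_poly[OF finite_freq_box]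
    by (rule order_trans[OF norm_sum]) (auto simp: a_def norm_mult intro!: sum_mono)
  ultimately show ?thesis
    using shift_form_le[of N a j] by (simp add: a_def)
qed

section \<open>The extremal polynomial\<close>

lemma min_coeff_eq:
  "min_coeff N k = (\<Prod>j\<in>UNIV. 1 / sqrt (real (N j) + 1) * sine_weight (N j) (k $ j))"
  by (simp add: min_coeff_def sine_weight_def)

lemma sum_min_coeff_squared: "(\<Sum>k\<in>freq_box N. (min_coeff N k)\<^sup>2) = 1"
proof -
  have "(\<Sum>k\<in>freq_box N. (min_coeff N k)\<^sup>2) =
      (\<Sum>k\<in>freq_box N. \<Prod>j\<in>UNIV. (sine_weight (N j) (k $ j))\<^sup>2 / (real (N j) + 1))"
    by (simp add: min_coeff_eq prod_power_distrib power_mult_distrib power_divide)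
  also have "\<dots> = (\<Prod>j\<in>UNIV. \<Sum>m\<in>{- int (N j)..int (N j)}. (sine_weight (N j) m)\<^sup>2 / (real (N j) + 1))"
    by (rule sum_freq_box_prod)
  also have "\<dots> = 1"
    by (simp add: sum_divide_distrib[symmetric] sum_sine_weight_squared add_nonneg_eq_0_iff)
  finally show ?thesis .
qed

text \<open>A shift along \<open>j\<close> alters only the \<open>j\<close>-th factor, so the
  product is proportional to the sine weights in every direction at once.\<close>

lemma min_coeff_shift:
  "min_coeff N (k - axis j 1) * sine_weight (N j) (k $ j) = min_coeff N k * sine_weight (N j) (k $ j - 1)"
proof -
  have "(\<Prod>i\<in>UNIV - {j}. 1 / sqrt (real (N i) + 1) * sine_weight (N i) ((k - axis j 1) $ i)) =
      (\<Prod>i\<in>UNIV - {j}. 1 / sqrt (real (N i) + 1) * sine_weight (N i) (k $ i))"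
    by (rule prod.cong) (auto simp: axis_def)
  then show ?thesis
    unfolding min_coeff_eq by (simp add: prod.remove[of UNIV j])
qed

lemma torus_norm_p_min: "torus_norm (p_min N) = 1"
  unfolding p_min_def torus_norm_trig_poly[OF finite_freq_box] by (simp add: sum_min_coeff_squared)

lemma shift_corr_p_min:
  "shift_corr (p_min N) j = of_real (cos (pi / (2 * real (N j) + 2)))"
proof -
  define a where "a k = (if k \<in> freq_box N then min_coeff N k else 0)" for k
  have "shift_corr (p_min N) j = of_real (\<Sum>k\<in>freq_box N. a (k - axis j 1) * a k)"
    unfolding p_min_def shift_corr_trig_poly[OF finite_freq_box] of_real_sum
    by (rule sum.cong) (auto simp: a_def)
  also have "(\<Sum>k\<in>freq_box N. a (k - axis j 1) * a k) =
      cos (pi / (2 * real (N j) + 2)) * (\<Sum>k\<in>freq_box N. (a k)\<^sup>2)"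
  proof (rule shift_form_eq)
    fix k assume k: "k \<in> freq_box N"
    \<comment> \<open>Inside the box this is \<open>min_coeff_shift\<close>; where the shift leaves
      it, the cut-off on the left matches the zero of the sine weight on the right.\<close>
    show "a (k - axis j 1) * sine_weight (N j) (k $ j) = a k * sine_weight (N j) (k $ j - 1)"
      using k freq_box_shift(1)[OF k, of j] min_coeff_shift[of N k j]
      by (auto simp: a_def sine_weight_lower)
  qed (simp add: a_def)
  also have "(\<Sum>k\<in>freq_box N. (a k)\<^sup>2) = 1"
    by (simp add: a_def sum_min_coeff_squared)
  finally show ?thesis
    by simp
qed

section \<open>Minimization of the variance\<close>

lemma cos_pi_div_pos:
  assumes "n > 0"
  shows "cos (pi / (2 * real n + 2)) > 0"
  using assms by (intro cos_gt_zero) (auto simp: field_simps)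

lemma var_GG_unit_norm:
  fixes f :: "real ^ 'd::finite \<Rightarrow> complex"
  assumes "torus_norm f = 1"
  shows "var_GG f = (if (\<Sum>j\<in>UNIV. cmod (shift_corr f j)) = 0 then \<infinity> else
    ereal ((real CARD('d) - (\<Sum>j\<in>UNIV. (cmod (shift_corr f j))\<^sup>2)) / (\<Sum>j\<in>UNIV. cmod (shift_corr f j))\<^sup>2))"
  by (simp add: var_GG_def assms sum_subtractf)

theorem theorem5:
  fixes N :: "'d::finite \<Rightarrow> nat"
  assumes "\<And>j. N j > 0"
  defines "A \<equiv> {p \<in> trig_polys (freq_box N). torus_norm p = 1}"
  shows "ereal (min_var N) \<in> var_GG ` A \<and> (\<forall>v \<in> var_GG ` A. ereal (min_var N) \<le> v)
    \<and> p_min N \<in> A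
    \<and> (\<forall>k \<in> freq_box N. fourier_coeff (p_min N) k = of_real (min_coeff N k))
    \<and> var_GG (p_min N) = ereal (min_var N)"
proof -
  define C where "C j = cos (pi / (2 * real (N j) + 2))" for j
  \<comment> \<open>Positivity of \<open>N j\<close> enters here: it puts the angle below
    \<open>pi / 2\<close>, which keeps the denominator for \<open>p_min N\<close> positive.\<close>
  have C: "C j > 0" for j
    unfolding C_def by (rule cos_pi_div_pos[OF assms(1)])
  then have C_sum: "(\<Sum>j\<in>UNIV. C j) > 0"
    by (intro sum_pos) auto
  have C_abs: "\<bar>C j\<bar> = C j" for j
    using C[of j] by simp
  have p_min: "p_min N \<in> A"
    using torus_norm_p_min[of N] unfolding A_def trig_polys_def p_min_def by blast
  have coeff: "\<forall>k \<in> freq_box N. fourier_coeff (p_min N) k = of_real (min_coeff N k)"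
    by (simp add: p_min_def fourier_coeff_trig_poly finite_freq_box)
  have var: "var_GG (p_min N) = ereal (min_var N)"
    using C_sum
    by (simp add: var_GG_unit_norm torus_norm_p_min shift_corr_p_min min_var_def C_def[symmetric] C_abs)
  have "ereal (min_var N) \<le> var_GG p" if "p \<in> A" for p
  proof -
    define q where "q j = cmod (shift_corr p j)" for j
    have norm: "torus_norm p = 1"
      using that by (simp add: A_def)
    have q: "0 \<le> q j" "q j \<le> C j" for j
      using that cmod_shift_corr_le[of p N j] by (auto simp: q_def C_def A_def)
    show ?thesis
    proof (cases "(\<Sum>j\<in>UNIV. q j) = 0")
      \<comment> \<open>A zero denominator gives variance \<infinity> by convention.\<close>
      case True
      then show ?thesis
        by (simp add: var_GG_unit_norm[OF norm] q_def)
    next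
      case False
      then have q_sum: "(\<Sum>j\<in>UNIV. q j) > 0"
        using q(1) by (simp add: less_le sum_nonneg)
      \<comment> \<open>Passing from \<open>q\<close> to \<open>C\<close> lowers the numerator and
        raises the denominator. Comparing the fractions also takes a nonnegative numerator, which
        holds since each \<open>C j\<close> is a cosine.\<close>
      have "(\<Sum>j\<in>UNIV. (C j)\<^sup>2) \<le> (\<Sum>j\<in>(UNIV :: 'd set). 1)"
        by (intro sum_mono) (simp add: C_def abs_square_le_1)
      then have "0 \<le> real CARD('d) - (\<Sum>j\<in>UNIV. (C j)\<^sup>2)"
        by simp
      moreover have "(\<Sum>j\<in>UNIV. (q j)\<^sup>2) \<le> (\<Sum>j\<in>UNIV. (C j)\<^sup>2)"
        by (intro sum_mono power_mono q)
      moreover have "(\<Sum>j\<in>UNIV. q j)\<^sup>2 \<le> (\<Sum>j\<in>UNIV. C j)\<^sup>2"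
        using q_sum by (intro power_mono sum_mono q) auto
      ultimately have "(real CARD('d) - (\<Sum>j\<in>UNIV. (C j)\<^sup>2)) / (\<Sum>j\<in>UNIV. C j)\<^sup>2 \<le>
          (real CARD('d) - (\<Sum>j\<in>UNIV. (q j)\<^sup>2)) / (\<Sum>j\<in>UNIV. q j)\<^sup>2"
        using q_sum by (intro frac_le) auto
      then show ?thesis
        using False by (simp add: var_GG_unit_norm[OF norm] q_def min_var_def C_def)
    qed
  qed
  then show ?thesis
    using p_min coeff var image_eqI[of "ereal (min_var N)" var_GG "p_min N" A] by auto
qed

end
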